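(* Let $X=Y^{*}$ be a dual Banach space and let $Q\subset X$ be a nonempty weak$^{*}$ compact convex subset with the Radon--Nikodým property. Let $(S,Q)$ be a dynamical system, where $Q$ carries the weak$^{*}$ topology, which is nonexpansive (with respect to the norm) and norm-distal. Then there is a fixed point of $S$ in $Q$, i.e. a point $x\in Q$ with $sx=x$ for every $s\in S$. Moreover, the set $F(S)=\{x\in Q: sx=x \text{ for every } s\in S\}$ is a nonexpansive retract of $Q$.
   Context: A dynamical system $(S,Q)$ consists of a semigroup $S$, a topological space $Q$ and a semigroup action $S\times Q\to Q$, $(s,x)\mapsto sx$ (so $(st)x=s(tx)$), such that for each $s\in S$ the map $Q\ni x\mapsto sx\in Q$ is continuous in the topology of $Q$. Here the topology on $Q$ is the weak$^{*}$ topology $\sigma(Y^{*},Y)$. $(S,Q)$ is nonexpansive if $\|sx-sy\|\le\|x-y\|$ for all $s\in S$, $x,y\in Q$. It is norm-distal if for every pair of distinct points $x,y\in Q$, $0$ does not belong to the norm closure of $\{sx-sy:s\in S\}$. A bounded set $A$ in a Banach space is dentable if for each $\varepsilon>0$ there is $x\in A$ such that $x\notin\overline{\mathrm{co}}(A\setminus B(x,\varepsilon))$, where $\overline{\mathrm{co}}$ denotes the norm-closed convex hull and $B(x,\varepsilon)$ the ball of radius $\varepsilon$ about $x$. A bounded closed convex set $C$ has the Radon--Nikodým property iff every bounded nonempty subset of $C$ is dentable. $F(S)$ is a nonexpansive retract of $Q$ if there is a map $r$ of $Q$ onto $F(S)$ with $r\circ r=r$ (equivalently, $r(Q)\subset F(S)$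 and $r(x)=x$ for $x\in F(S)$) such that $\|r(x)-r(y)\|\le\|x-y\|$ for all $x,y\in Q$; weak$^{*}$ continuity of $r$ is not required. *)

theory Defs
  imports "HOL-Analysis.Analysis"
begin

(* On the dual space 'y \<Rightarrow>\<^sub>L real the topology of pointwise convergence of
   functionals is sigma(Y*, Y). *)
definition weak_star_topology :: "('y::real_normed_vector \<Rightarrow>\<^sub>L real) topology" where
  "weak_star_topology = strong_operator_topology"

(* continuous_map also yields the invariance of the space under every act s.
   Only the values of act s on topspace T matter. *)
definition dynamical_system :: "('s::semigroup_mult \<Rightarrow> 'a \<Rightarrow> 'a) \<Rightarrow> 'a topology \<Rightarrow> bool" where
  "dynamical_system act T \<longleftrightarrow>
     (\<forall>s. continuous_map T T (act s)) \<and>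
     (\<forall>s t. \<forall>x\<in>topspace T. act (s * t) x = act s (act t x))"

definition nonexpansive_action :: "('s \<Rightarrow> 'a::real_normed_vector \<Rightarrow> 'a) \<Rightarrow> 'a set \<Rightarrow> bool" where
  "nonexpansive_action act Q \<longleftrightarrow>
     (\<forall>s. \<forall>x\<in>Q. \<forall>y\<in>Q. norm (act s x - act s y) \<le> norm (x - y))"

definition norm_distal :: "('s \<Rightarrow> 'a::real_normed_vector \<Rightarrow> 'a) \<Rightarrow> 'a set \<Rightarrow> bool" where
  "norm_distal act Q \<longleftrightarrow>
     (\<forall>x\<in>Q. \<forall>y\<in>Q. x \<noteq> y \<longrightarrow> 0 \<notin> closure {act s x - act s y | s. True})"

definition dentable :: "'a::real_normed_vector set \<Rightarrow> bool" where
  "dentable A \<longleftrightarrow>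
     (\<forall>\<epsilon>>0. \<exists>x\<in>A. x \<notin> closure (convex hull (A - ball x \<epsilon>)))"

(* Intended for bounded closed convex C. *)
definition radon_nikodym_property :: "'a::real_normed_vector set \<Rightarrow> bool" where
  "radon_nikodym_property C \<longleftrightarrow>
     (\<forall>A. A \<subseteq> C \<and> bounded A \<and> A \<noteq> {} \<longrightarrow> dentable A)"

definition fixed_points :: "('s \<Rightarrow> 'a \<Rightarrow> 'a) \<Rightarrow> 'a set \<Rightarrow> 'a set" where
  "fixed_points act Q = {x \<in> Q. \<forall>s. act s x = x}"

definition nonexpansive_retract_of :: "'a::real_normed_vector set \<Rightarrow> 'a set \<Rightarrow> bool" where
  "nonexpansive_retract_of F Q \<longleftrightarrow>
     F \<subseteq> Q \<and>
     (\<exists>r. r ` Q = F \<and> (\<forall>x\<in>Q. r (r x) = r x) \<and>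
          (\<forall>x\<in>Q. \<forall>y\<in>Q. norm (r x - r y) \<le> norm (x - y)))"

end

theory Submission
  imports Defs
begin

text \<open>
  The fixed point theorem would follow from DeMarr's argument if the action were by surjective
  isometries of a norm compact set: an invariant set of diameter \<open>d > 0\<close> then has a point in its
  convex hull all of whose distances to the set are smaller than \<open>d\<close>, and minimality of the
  surrounding convex invariant set is contradicted. The work is to produce such a situation on a
  minimal weak* compact invariant set \<open>M\<close>, where only a nonexpansive weak* continuous action is
  given.

  The Radon--Nikodym property makes \<open>M\<close> fragmented, that is, there are weak* open sets meeting \<open>M\<close> in
  sets of arbitrarily small norm diameter; otherwise \<open>Q\<close> would contain a bounded dyadic tree, which
  is not dentable (\<open>radon_nikodym_fragmented\<close>). Since orbits in \<open>M\<close> are weak* dense, they enter these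
  sets. This turns norm-distality into distality for the weak* topology, for which the theorem of
  Ellis applies: the closure of the semigroup is a group (\<open>distal_semigroup_invertible\<close>). Its
  elements are nonexpansive since the dual norm is weak* lower semicontinuous, and a group of
  nonexpansive maps consists of isometries (\<open>minimal_action_isometric\<close>). Finally \<open>M\<close> is covered by
  finitely many preimages of a set of small diameter, which replaces norm compactness in DeMarr's
  argument (\<open>distal_nonexpansive_fixed_point\<close>).

  The hypotheses pass to weak* compact convex invariant subsets of \<open>Q\<close>, so each of these contains a
  fixed point. This is what Bruck's construction of nonexpansive retractions needs
  (\<open>fixed_points_nonexpansive_retract\<close>).
\<close>

section \<open>Minimal closed sets and distal semigroups\<close>

text \<open>
  Zorn's lemma for closed subsets of a compact space, shrinking instead of growing: a chain of
  nonempty closed sets has nonempty intersection. It is used for invariant sets, for convex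
  invariant sets, for subsemigroups and for down-sets of maps, all of which are stable under
  intersections.
\<close>

lemma minimal_closed_set:
  assumes X: "compact_space X" and A0: "closedin X A0" "A0 \<noteq> {}" "P A0"
    and Inter: "\<And>\<A>. \<lbrakk>\<A> \<noteq> {}; \<And>A. A \<in> \<A> \<Longrightarrow> P A\<rbrakk> \<Longrightarrow> P (\<Inter>\<A>)"
  obtains A where "A \<subseteq> A0" "closedin X A" "A \<noteq> {}" "P A"
    "\<And>B. \<lbrakk>closedin X B; B \<noteq> {}; P B; B \<subseteq> A\<rbrakk> \<Longrightarrow> B = A"
proof -
  define \<F> where "\<F> = {A. A \<subseteq> A0 \<and> closedin X A \<and> A \<noteq> {} \<and> P A}"
  \<comment> \<open>Complements turn minimal members into maximal ones, the form in which Zorn's lemma is stated.\<close>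
  have "\<exists>M\<in>uminus ` \<F>. \<forall>B\<in>uminus ` \<F>. M \<subseteq> B \<longrightarrow> B = M"
  proof (rule subset_Zorn_nonempty)
    show "uminus ` \<F> \<noteq> {}"
      using A0 by (auto simp: \<F>_def)
  next
    fix \<C> assume "\<C> \<noteq> {}" and chain: "subset.chain (uminus ` \<F>) \<C>"
    define \<D> where "\<D> = uminus ` \<C>"
    have \<C>: "\<Union>\<C> = - \<Inter>\<D>"
      by (auto simp: \<D>_def)
    have \<D>: "\<D> \<subseteq> \<F>" "\<D> \<noteq> {}"
      using chain \<open>\<C> \<noteq> {}\<close> by (auto simp: \<D>_def subset_chain_def)
    have lin: "A \<subseteq> B \<or> B \<subseteq> A" if "A \<in> \<D>" "B \<in> \<D>" for A B
      using chain that unfolding subset_chain_def \<D>_def by blast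
    have fin: "\<Inter>\<G> \<in> \<G>" if "finite \<G>" "\<G> \<noteq> {}" "\<G> \<subseteq> \<D>" for \<G>
      using that
    proof (induction rule: finite_ne_induct)
      case (insert A \<G>)
      then have "A \<subseteq> \<Inter>\<G> \<or> \<Inter>\<G> \<subseteq> A"
        using lin[of A "\<Inter>\<G>"] by auto
      then have "\<Inter>(insert A \<G>) = A \<or> \<Inter>(insert A \<G>) = \<Inter>\<G>"
        by (auto simp only: Inter_insert Int_absorb1 Int_absorb2)
      then show ?case
        using insert by auto
    qed auto
    have "\<Inter>\<G> \<noteq> {}" if "finite \<G>" "\<G> \<subseteq> \<D>" for \<G>
      using fin[OF that(1) _ that(2)] that \<D> by (cases "\<G> = {}") (auto simp: \<F>_def)
    moreover have "\<forall>A\<in>\<D>. closedin X A"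
      using \<D> by (auto simp: \<F>_def)
    ultimately have "\<Inter>\<D> \<noteq> {}"
      using X[unfolded compact_space_fip, rule_format, of \<D>] by simp
    moreover have "P (\<Inter>\<D>)" "closedin X (\<Inter>\<D>)" "\<Inter>\<D> \<subseteq> A0"
      using \<D> by (auto intro!: Inter closedin_Inter simp: \<F>_def)
    ultimately show "\<Union>\<C> \<in> uminus ` \<F>"
      unfolding \<C> by (auto simp: \<F>_def)
  qed
  then obtain A where "A \<in> \<F>" "\<And>B. B \<in> \<F> \<Longrightarrow> B \<subseteq> A \<Longrightarrow> B = A"
    by auto
  then show thesis
    using that[of A] unfolding \<F>_def by blast
qed

text \<open>
  A minimal closed subsemigroup \<open>A\<close> has no room for anything but idempotents: for \<open>u \<in> A\<close>, the set
  \<open>A \<odot> u\<close> is again a closed subsemigroup, so it is all of \<open>A\<close> and contains \<open>u\<close>; hence the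
  stabilizer \<open>{a \<in> A. a \<odot> u = u}\<close> is nonempty, and by minimality it contains \<open>u\<close>.
\<close>

lemma Ellis_Numakura:
  fixes mult :: "'a \<Rightarrow> 'a \<Rightarrow> 'a" (infixl "\<odot>" 70)
  assumes X: "compact_space X" "Hausdorff_space X"
    and cont: "\<And>a. a \<in> topspace X \<Longrightarrow> continuous_map X X (\<lambda>b. b \<odot> a)"
    and assoc: "\<And>a b c. \<lbrakk>a \<in> topspace X; b \<in> topspace X; c \<in> topspace X\<rbrakk>
                  \<Longrightarrow> (a \<odot> b) \<odot> c = a \<odot> (b \<odot> c)"
    and A0: "closedin X A0" "A0 \<noteq> {}" "\<And>a b. \<lbrakk>a \<in> A0; b \<in> A0\<rbrakk> \<Longrightarrow> a \<odot> b \<in> A0"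
  shows "\<exists>u\<in>A0. u \<odot> u = u"
proof -
  define semi where "semi A \<longleftrightarrow> (\<forall>a\<in>A. \<forall>b\<in>A. a \<odot> b \<in> A)" for A
  obtain A where A: "A \<subseteq> A0" "closedin X A" "A \<noteq> {}" "semi A"
    and min: "\<And>B. \<lbrakk>closedin X B; B \<noteq> {}; semi B; B \<subseteq> A\<rbrakk> \<Longrightarrow> B = A"
  proof (rule minimal_closed_set[of X A0 semi])
    show "semi A0"
      using A0 by (simp add: semi_def)
    show "semi (\<Inter>\<A>)" if "\<And>A. A \<in> \<A> \<Longrightarrow> semi A" for \<A>
      using that unfolding semi_def by blast
  qed (use X A0 in auto)
  have top: "A \<subseteq> topspace X"
    using A closedin_subset by blast
  obtain u where u: "u \<in> A"
    using A by blast
  have "(\<lambda>a. a \<odot> u) ` A = A"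
  proof (rule min)
    have "compactin X ((\<lambda>a. a \<odot> u) ` A)"
      using closedin_compact_space[OF X(1) A(2)] cont u top by (blast intro: image_compactin)
    then show "closedin X ((\<lambda>a. a \<odot> u) ` A)"
      using X compactin_imp_closedin by blast
    show "(\<lambda>a. a \<odot> u) ` A \<noteq> {}" "(\<lambda>a. a \<odot> u) ` A \<subseteq> A"
      using A u by (auto simp: semi_def)
    show "semi ((\<lambda>a. a \<odot> u) ` A)"
      unfolding semi_def
    proof clarify
      fix a b assume ab: "a \<in> A" "b \<in> A"
      then have "(a \<odot> u) \<odot> (b \<odot> u) = (a \<odot> u \<odot> b) \<odot> u"
        using A u top assoc by (simp add: semi_def subset_iff)
      then show "(a \<odot> u) \<odot> (b \<odot> u) \<in> (\<lambda>a. a \<odot> u) ` A"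
        using A u ab by (auto simp: semi_def)
    qed
  qed
  then have ne: "{a \<in> A. a \<odot> u = u} \<noteq> {}"
    using u by force
  have "{a \<in> A. a \<odot> u = u} = A"
  proof (rule min)
    show "closedin X {a \<in> A. a \<odot> u = u}"
      using closedin_continuous_map_preimage_gen[OF cont A(2), of u "{u}"] u top X
      by (auto simp: closedin_Hausdorff_singleton)
    show "semi {a \<in> A. a \<odot> u = u}"
      using A(4) u top assoc by (auto simp: semi_def subset_iff)
  qed (use ne in auto)
  then show ?thesis
    using u A by blast
qed

text \<open>
  Ellis' theorem: the closure \<open>E\<close> of a distal semigroup in the product topology consists of
  injective maps, because the values of \<open>f \<in> E\<close> at a pair of points are limits of the values of
  members of \<open>G\<close> at that pair. An injective idempotent is the identity, so the Ellis--Numakura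
  lemma, applied to \<open>E \<circ> f\<close>, gives every \<open>f \<in> E\<close> a left inverse in \<open>E\<close>, and \<open>E\<close> is a group.
  The conclusions are what the existence of inverses means for a single \<open>g \<in> G\<close>: the motion of a
  pair under \<open>g\<close> can be undone in the limit, and \<open>g\<close> is onto.
\<close>

lemma distal_semigroup_invertible:
  fixes G :: "('a \<Rightarrow> 'a) set"
  assumes X: "compact_space X" "Hausdorff_space X"
    and cont: "\<And>g. g \<in> G \<Longrightarrow> continuous_map X X g"
    and comp: "\<And>g h. \<lbrakk>g \<in> G; h \<in> G\<rbrakk> \<Longrightarrow> \<exists>k\<in>G. \<forall>x\<in>topspace X. k x = g (h x)"
    and distal: "\<And>x y z. \<lbrakk>x \<in> topspace X; y \<in> topspace X; x \<noteq> y\<rbrakk>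
                  \<Longrightarrow> (z, z) \<notin> prod_topology X X closure_of (\<lambda>g. (g x, g y)) ` G"
    and g: "g \<in> G"
  shows "\<And>x y. \<lbrakk>x \<in> topspace X; y \<in> topspace X\<rbrakk>
            \<Longrightarrow> (x, y) \<in> prod_topology X X closure_of (\<lambda>h. (h (g x), h (g y))) ` G"
    and "topspace X \<subseteq> g ` topspace X"
proof -
  define M where "M = topspace X"
  define XM where "XM = product_topology (\<lambda>_. X) M"
  define H where "H = (\<lambda>g. restrict g M) ` G"
  define E where "E = XM closure_of H"
  have GM: "g w \<in> M" if "g \<in> G" "w \<in> M" for g w
    using cont[OF that(1)] that(2) by (auto simp: M_def continuous_map_def Pi_iff)
  have topXM: "topspace XM = (\<Pi>\<^sub>E _\<in>M. M)"
    by (simp add: XM_def M_def)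
  have H: "H \<subseteq> topspace XM"
    using GM by (auto simp: H_def topXM)
  have HE: "H \<subseteq> E"
    using H closure_of_subset by (auto simp: E_def)
  have cXM: "compact_space XM" "Hausdorff_space XM"
    using X by (auto simp: XM_def compact_space_product_topology Hausdorff_space_product_topology)
  have E: "closedin XM E" "E \<subseteq> topspace XM"
    by (auto simp: E_def closure_of_subset_topspace)
  have contR: "continuous_map XM XM (\<lambda>e. compose M e f)" if "f \<in> topspace XM" for f
    unfolding XM_def continuous_map_componentwise
    using that by (auto simp: compose_def topXM intro!: continuous_map_product_projection)
  have contL: "continuous_map XM XM (\<lambda>f. compose M h f)" if "h \<in> G" for h
    unfolding XM_def continuous_map_componentwise
    using continuous_map_compose[OF continuous_map_product_projection[where X = "\<lambda>_. X"] cont[OF that]]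
    by (auto simp: compose_def o_def)
  \<comment> \<open>\<open>E\<close> is a semigroup: composition is continuous in the left factor for every fixed map, but in
     the right factor only if the left factor is continuous. So closures are taken in the right
     factor first, with the left factor in \<open>H\<close>, and then in the left factor.\<close>
  have composeH: "compose M h f \<in> H" if hf: "h \<in> H" "f \<in> H" for h f
  proof -
    obtain a b where ab: "a \<in> G" "b \<in> G" "h = restrict a M" "f = restrict b M"
      using hf unfolding H_def by blast
    then obtain k where "k \<in> G" "\<forall>x\<in>M. k x = a (b x)"
      using comp M_def by metis
    then have "compose M h f = restrict k M"
      using ab GM by (auto simp: compose_def fun_eq_iff)
    then show ?thesis
      using \<open>k \<in> G\<close> by (auto simp: H_def)
  qed
  have composeHE: "compose M h f \<in> E" if hf: "h \<in> H" "f \<in> E" for h f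
  proof -
    obtain a where a: "a \<in> G" "h = restrict a M"
      using hf unfolding H_def by blast
    have eq: "compose M h k = compose M a k" if "k \<in> topspace XM" for k
      using that a by (auto simp: compose_def topXM fun_eq_iff)
    have "compose M a ` E \<subseteq> XM closure_of (compose M a ` H)"
      unfolding E_def by (rule continuous_map_image_closure_subset) (use contL[OF a(1)] in simp)
    also have "\<dots> \<subseteq> E"
      unfolding E_def by (rule closure_of_mono) (use composeH[OF hf(1)] eq H in force)
    finally show ?thesis
      using hf E eq by auto
  qed
  have composeE: "compose M e f \<in> E" if "e \<in> E" "f \<in> E" for e f
  proof -
    have "(\<lambda>e. compose M e f) ` E \<subseteq> XM closure_of ((\<lambda>e. compose M e f) ` H)"
      unfolding E_def by (rule continuous_map_image_closure_subset) (use contR that E in auto)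
    also have "\<dots> \<subseteq> E"
      by (rule closure_of_minimal) (use composeHE that E in auto)
    finally show ?thesis
      using that by auto
  qed
  have pair: "(f v, f w) \<in> prod_topology X X closure_of (\<lambda>h. (h v, h w)) ` G"
    if "f \<in> E" "v \<in> M" "w \<in> M" for f v w
  proof -
    have "continuous_map XM (prod_topology X X) (\<lambda>f. (f v, f w))"
      unfolding XM_def continuous_map_pairwise o_def
      using that by (auto intro!: continuous_map_product_projection)
    then have "(\<lambda>f. (f v, f w)) ` E \<subseteq> prod_topology X X closure_of ((\<lambda>f. (f v, f w)) ` H)"
      unfolding E_def by (rule continuous_map_image_closure_subset)
    also have "(\<lambda>f. (f v, f w)) ` H = (\<lambda>h. (h v, h w)) ` G"
      using that by (auto simp: H_def image_image)
    finally show ?thesis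
      using that by auto
  qed
  have inj: "v = w" if "f \<in> E" "v \<in> M" "w \<in> M" "f v = f w" for f v w
    using pair[OF that(1-3)] distal[of v w "f w"] that by (auto simp: M_def)
  have inverse: "\<exists>e\<in>E. \<forall>v\<in>M. e (f v) = v" if f: "f \<in> E" for f
  proof -
    define A where "A = (\<lambda>e. compose M e f) ` E"
    have "compactin XM A"
      unfolding A_def using closedin_compact_space[OF cXM(1) E(1)] contR f E
      by (blast intro: image_compactin)
    then have "closedin XM A"
      using cXM compactin_imp_closedin by blast
    have "\<exists>u\<in>A. compose M u u = u"
    proof (rule Ellis_Numakura[OF cXM, where mult = "compose M"])
      show "compose M (compose M a b) c = compose M a (compose M b c)"
        if "a \<in> topspace XM" "b \<in> topspace XM" "c \<in> topspace XM" for a b c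
        using that by (auto simp: topXM compose_def fun_eq_iff)
      show "A \<noteq> {}"
        using f by (auto simp: A_def)
      show "compose M a b \<in> A" if "a \<in> A" "b \<in> A" for a b
      proof -
        obtain d e where "d \<in> E" "e \<in> E" "a = compose M d f" "b = compose M e f"
          using \<open>a \<in> A\<close> \<open>b \<in> A\<close> by (auto simp: A_def)
        moreover from this have "compose M a b = compose M (compose M a e) f"
          using f E by (auto simp: topXM compose_def fun_eq_iff subset_iff)
        ultimately show ?thesis
          using f composeE by (auto simp: A_def)
      qed
    qed (use \<open>closedin XM A\<close> contR in auto)
    then obtain e where e: "e \<in> E" and idem: "compose M (compose M e f) (compose M e f) = compose M e f"
      by (auto simp: A_def)
    have u: "compose M e f \<in> E"
      using e f composeE by blast
    have "e (f v) = v" if "v \<in> M" for v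
    proof -
      have "e (f v) \<in> M"
        using u E that by (force simp: topXM compose_def subset_iff)
      moreover have "e (f (e (f v))) = e (f v)"
        using fun_cong[OF idem, of v] that \<open>e (f v) \<in> M\<close> by (simp add: compose_def)
      ultimately show ?thesis
        using inj[OF u, of "e (f v)" v] that by (simp add: compose_def)
    qed
    then show ?thesis
      using e by blast
  qed
  have gE: "restrict g M \<in> E"
    using g HE by (auto simp: H_def)
  then obtain e where e: "e \<in> E" "\<And>v. v \<in> M \<Longrightarrow> e (g v) = v"
    using inverse[OF gE] by auto
  show "(x, y) \<in> prod_topology X X closure_of (\<lambda>h. (h (g x), h (g y))) ` G"
    if "x \<in> topspace X" "y \<in> topspace X" for x y
    using pair[OF e(1), of "g x" "g y"] e(2) that GM[OF g] by (simp add: M_def)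
  have eM: "e v \<in> M" if "v \<in> M" for v
    using that e E by (force simp: topXM subset_iff)
  \<comment> \<open>The left inverse \<open>e\<close> of \<open>g\<close> is a right inverse too, since \<open>e\<close> is injective.\<close>
  have "g (e x) = x" if "x \<in> M" for x
    using inj[OF e(1), of "g (e x)" x] e(2)[OF eM] eM GM[OF g] that by simp
  then show "topspace X \<subseteq> g ` topspace X"
    using eM unfolding M_def by (metis image_eqI subsetI)
qed

section \<open>The weak* topology of a dual space\<close>

lemma topspace_weak_star [simp]: "topspace weak_star_topology = UNIV"
  by (simp add: weak_star_topology_def strong_operator_topology_topspace)

lemma continuous_map_weak_star_iff:
  "continuous_map X weak_star_topology f \<longleftrightarrow>
     (\<forall>y. continuous_map X euclideanreal (\<lambda>p. blinfun_apply (f p) y))"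
  by (simp add: weak_star_topology_def continuous_on_strong_operator_topo_iff_coordinatewise)

lemma continuous_map_weak_star_eval:
  "continuous_map X weak_star_topology f \<Longrightarrow> continuous_map X euclideanreal (\<lambda>p. blinfun_apply (f p) y)"
  by (simp add: continuous_map_weak_star_iff)

lemma continuous_map_weak_star_apply:
  "continuous_map weak_star_topology euclideanreal (\<lambda>f. blinfun_apply f y)"
  by (rule continuous_map_weak_star_eval) simp

lemma openin_weak_star_vimage_apply:
  assumes "open W"
  shows "openin weak_star_topology {f. blinfun_apply f y \<in> W}"
  using openin_continuous_map_preimage[OF continuous_map_weak_star_apply, of W] assms by simp

lemma Hausdorff_weak_star: "Hausdorff_space weak_star_topology"
  unfolding Hausdorff_space_def
proof (intro allI impI, elim conjE)
  fix f g :: "'a \<Rightarrow>\<^sub>L real" assume "f \<noteq> g"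
  then obtain y where "blinfun_apply f y \<noteq> blinfun_apply g y"
    by (meson blinfun_eqI)
  then obtain U V where UV: "open U" "open V" "blinfun_apply f y \<in> U" "blinfun_apply g y \<in> V" "U \<inter> V = {}"
    by (meson separation_t2)
  show "\<exists>U V. openin weak_star_topology U \<and> openin weak_star_topology V \<and> f \<in> U \<and> g \<in> V \<and> disjnt U V"
    by (rule exI[of _ "{h. blinfun_apply h y \<in> U}"], rule exI[of _ "{h. blinfun_apply h y \<in> V}"])
       (use UV openin_weak_star_vimage_apply in \<open>auto simp: disjnt_def\<close>)
qed

text \<open>
  The dual norm is a supremum of evaluations, hence weak* lower semicontinuous. All passages to
  weak* limits in norm inequalities rest on this.
\<close>

lemma closedin_norm_diff_le:
  assumes f: "continuous_map X weak_star_topology f" and g: "continuous_map X weak_star_topology g"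
  shows "closedin X {p \<in> topspace X. norm (f p - g p) \<le> r}"
proof (cases "0 \<le> r")
  case True
  have iff: "norm h \<le> r \<longleftrightarrow> (\<forall>y. \<bar>blinfun_apply h y\<bar> \<le> r * norm y)" for h :: "'b \<Rightarrow>\<^sub>L real"
  proof
    show "\<forall>y. \<bar>blinfun_apply h y\<bar> \<le> r * norm y" if "norm h \<le> r"
      by (metis norm_blinfun mult_right_mono norm_ge_zero order_trans real_norm_def that)
    show "norm h \<le> r" if "\<forall>y. \<bar>blinfun_apply h y\<bar> \<le> r * norm y"
      using that by (intro norm_blinfun_bound True) auto
  qed
  have "{p \<in> topspace X. norm (f p - g p) \<le> r} =
      (\<Inter>y. {p \<in> topspace X. blinfun_apply (f p) y - blinfun_apply (g p) y \<in> cball 0 (r * norm y)})"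
    by (auto simp: iff blinfun.diff_left)
  moreover have "closedin X {p \<in> topspace X. blinfun_apply (f p) y - blinfun_apply (g p) y
                                  \<in> cball 0 (r * norm y)}" for y
    by (rule closedin_continuous_map_preimage)
       (auto intro!: continuous_map_diff continuous_map_weak_star_eval f g)
  ultimately show ?thesis
    by auto
next
  case False
  then have "{p \<in> topspace X. norm (f p - g p) \<le> r} = {}"
    using norm_ge_zero order_trans by blast
  then show ?thesis
    by (simp only: closedin_empty)
qed

text \<open>
  The uniform boundedness principle. It is the place where completeness of the predual enters:
  a weak* compact set is bounded, as the dentability of its subsets presupposes.
\<close>

lemma pointwise_bounded_imp_bounded:
  fixes Q :: "('y::banach \<Rightarrow>\<^sub>L real) set"
  assumes "\<And>y. bounded ((\<lambda>f. blinfun_apply f y) ` Q)"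
  shows "bounded Q"
proof -
  define C where "C n = {y. \<forall>f\<in>Q. \<bar>blinfun_apply f y\<bar> \<le> real n}" for n :: nat
  have C: "closed (C n)" for n
  proof -
    have "C n = (\<Inter>f\<in>Q. {y. \<bar>blinfun_apply f y\<bar> \<le> real n})"
      by (auto simp: C_def)
    then show ?thesis
      by (auto intro!: closed_Collect_le continuous_intros)
  qed
  have "y \<in> (\<Union>n. C n)" for y
  proof -
    obtain b where b: "\<And>f. f \<in> Q \<Longrightarrow> \<bar>blinfun_apply f y\<bar> \<le> b"
      using assms[of y] by (auto simp: bounded_iff)
    obtain n where "b \<le> real n"
      using real_arch_simple by blast
    then have "y \<in> C n"
      using b order_trans by (fastforce simp: C_def)
    then show ?thesis
      by blast
  qed
  then have "(\<Union>n. C n) = UNIV"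
    by blast
  moreover have "interior (\<Union>n. C n) = {}" if "\<And>n. interior (C n) = {}"
    using Baire_category_alt[of euclidean "range C"] that C
    by (simp add: completely_metrizable_space_euclidean image_iff) force
  ultimately obtain n where "interior (C n) \<noteq> {}"
    by force
  then obtain z e where e: "0 < e" "ball z e \<subseteq> C n"
    by (meson ex_in_conv mem_interior)
  have "norm f \<le> 4 * real n / e" if "f \<in> Q" for f
  proof (rule norm_blinfun_bound)
    fix y
    show "norm (blinfun_apply f y) \<le> 4 * real n / e * norm y"
    proof (cases "y = 0")
      case False
      \<comment> \<open>Scaled to length \<open>e / 2\<close>, so that \<open>z + w\<close> stays in the ball.\<close>
      define w where "w = (e / (2 * norm y)) *\<^sub>R y"
      have "z \<in> C n" "z + w \<in> C n"
        using e False by (auto intro!: subsetD[OF e(2)] simp: w_def dist_norm)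
      then have "\<bar>blinfun_apply f z\<bar> \<le> n" "\<bar>blinfun_apply f z + blinfun_apply f w\<bar> \<le> n"
        using that by (auto simp: C_def blinfun.add_right)
      then have "\<bar>blinfun_apply f w\<bar> \<le> 2 * n"
        by linarith
      then have "(e / (2 * norm y)) * \<bar>blinfun_apply f y\<bar> \<le> 2 * n"
        using e by (simp add: w_def blinfun.scaleR_right abs_mult)
      then show ?thesis
        using e False by (simp add: field_simps)
    qed simp
  qed (use e in auto)
  then show ?thesis
    by (auto simp: bounded_iff)
qed

lemma weak_star_compact_imp_bounded:
  fixes Q :: "('y::banach \<Rightarrow>\<^sub>L real) set"
  assumes "compactin weak_star_topology Q"
  shows "bounded Q"
proof (rule pointwise_bounded_imp_bounded)
  fix y
  have "compactin euclideanreal ((\<lambda>f. blinfun_apply f y) ` Q)"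
    using assms continuous_map_weak_star_apply
    by (rule image_compactin)
  then show "bounded ((\<lambda>f. blinfun_apply f y) ` Q)"
    by (simp add: compact_imp_bounded)
qed

section \<open>Fragmentability from the Radon--Nikodym property\<close>

text \<open>
  If \<open>M\<close> has two distant points in a weak* open set, then this set contains two smaller ones, both
  meeting \<open>M\<close>, that a vector of the unit ball of the predual separates by a gap \<open>\<epsilon>\<close>: a vector that
  almost norms \<open>x - x'\<close> does this. This is the branching step of the dyadic tree below. The
  separation is by half-spaces, so the gap survives averaging.
\<close>

lemma split_large_diameter:
  fixes M :: "('y::real_normed_vector \<Rightarrow>\<^sub>L real) set"
  assumes U: "openin weak_star_topology U" and "x \<in> U \<inter> M" "x' \<in> U \<inter> M"
    and gt: "norm (x - x') > \<epsilon>" and "0 < \<epsilon>"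
  obtains y U0 U1 a where "norm y \<le> 1"
    "openin weak_star_topology U0" "U0 \<subseteq> U" "U0 \<inter> M \<noteq> {}" "\<And>z. z \<in> U0 \<Longrightarrow> a + \<epsilon> \<le> blinfun_apply z y"
    "openin weak_star_topology U1" "U1 \<subseteq> U" "U1 \<inter> M \<noteq> {}" "\<And>z. z \<in> U1 \<Longrightarrow> blinfun_apply z y \<le> a"
proof -
  obtain v where v: "\<bar>blinfun_apply (x - x') v\<bar> > \<epsilon> * norm v"
    using norm_blinfun_bound[of \<epsilon> "x - x'"] gt \<open>0 < \<epsilon>\<close> by (metis less_imp_le not_le real_norm_def)
  then have "v \<noteq> 0"
    by auto
  define y where "y = (sgn (blinfun_apply (x - x') v) / norm v) *\<^sub>R v"
  have "norm y \<le> 1"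
    using \<open>v \<noteq> 0\<close> by (simp add: y_def abs_sgn_eq)
  have "blinfun_apply (x - x') y = \<bar>blinfun_apply (x - x') v\<bar> / norm v"
    by (simp add: y_def blinfun.scaleR_right abs_sgn mult.commute)
  also have "\<dots> > \<epsilon>"
    using v \<open>v \<noteq> 0\<close> by (simp add: field_simps)
  finally have "\<epsilon> < blinfun_apply x y - blinfun_apply x' y"
    by (simp add: blinfun.diff_left)
  then obtain a where a: "blinfun_apply x' y < a" "a + \<epsilon> < blinfun_apply x y"
    using dense[of "blinfun_apply x' y" "blinfun_apply x y - \<epsilon>"] by (auto simp: algebra_simps)
  show thesis
  proof (rule that[of y "U \<inter> {h. blinfun_apply h y \<in> {a + \<epsilon><..}}" a "U \<inter> {h. blinfun_apply h y \<in> {..<a}}"])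
    show "openin weak_star_topology (U \<inter> {h. blinfun_apply h y \<in> {a + \<epsilon><..}})"
         "openin weak_star_topology (U \<inter> {h. blinfun_apply h y \<in> {..<a}})"
      by (intro openin_Int U openin_weak_star_vimage_apply open_greaterThan open_lessThan)+
  qed (use a assms(2,3) \<open>norm y \<le> 1\<close> in auto)
qed

text \<open>
  Every node of the tree is the midpoint of its two successors, both of which lie outside a ball of
  fixed radius about it. So no node can be cut off.
\<close>

lemma dyadic_tree_not_dentable:
  fixes b :: "bool list \<Rightarrow> 'a::real_normed_vector"
  assumes mid: "\<And>\<sigma>. b \<sigma> = (1/2) *\<^sub>R (b (True # \<sigma>) + b (False # \<sigma>))"
    and gap: "\<And>\<sigma>. \<epsilon> \<le> norm (b (True # \<sigma>) - b (False # \<sigma>))" and "0 < \<epsilon>"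
  shows "\<not> dentable (range b)"
proof
  assume "dentable (range b)"
  then obtain \<sigma> where \<sigma>: "b \<sigma> \<notin> closure (convex hull (range b - ball (b \<sigma>) (\<epsilon>/2)))"
    using \<open>0 < \<epsilon>\<close> unfolding dentable_def by (metis half_gt_zero imageE)
  let ?x = "b (True # \<sigma>)" and ?y = "b (False # \<sigma>)"
  have "b \<sigma> - ?x = (1/2) *\<^sub>R (?y - ?x)" "b \<sigma> - ?y = (1/2) *\<^sub>R (?x - ?y)"
    by (subst mid, simp add: algebra_simps flip: scaleR_add_left)+
  then have "dist (b \<sigma>) ?x = norm (?x - ?y) / 2" "dist (b \<sigma>) ?y = norm (?x - ?y) / 2"
    by (simp_all add: dist_norm norm_minus_commute)
  then have "?x \<in> range b - ball (b \<sigma>) (\<epsilon>/2)" "?y \<in> range b - ball (b \<sigma>) (\<epsilon>/2)"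
    using gap[of \<sigma>] by auto
  then have "(1/2) *\<^sub>R ?x + (1/2) *\<^sub>R ?y \<in> convex hull (range b - ball (b \<sigma>) (\<epsilon>/2))"
    by (intro convexD[OF convex_convex_hull] hull_inc) auto
  then have "b \<sigma> \<in> convex hull (range b - ball (b \<sigma>) (\<epsilon>/2))"
    by (subst mid) (simp add: scaleR_add_right)
  with \<sigma> show False
    using closure_subset by blast
qed

text \<open>
  The Radon--Nikodym property speaks about norm closed convex hulls, while the dynamics needs weak*
  open sets of small diameter. The bridge is an indirect argument. If no weak* open set met \<open>M\<close> in
  a set of diameter at most \<open>\<epsilon>\<close>, then repeated splitting would give a dyadic tree of weak* open sets
  \<open>V \<sigma>\<close> with separating vectors \<open>y\<close>. For each finite depth, choosing points of \<open>M\<close> in the sets at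
  this depth and averaging them upwards gives a tree of points of \<open>Q\<close> in which each node is the
  midpoint of its successors and the successors differ by at least \<open>\<epsilon>\<close> at \<open>y\<close>. Both requirements
  are weak* closed, so by compactness there is an infinite tree with these properties, which is a
  bounded subset of \<open>Q\<close> that is not dentable.
\<close>

lemma radon_nikodym_fragmented:
  fixes Q M :: "('y::banach \<Rightarrow>\<^sub>L real) set"
  assumes comp: "compactin weak_star_topology Q" and "convex Q" and rnp: "radon_nikodym_property Q"
    and M: "M \<subseteq> Q" "M \<noteq> {}" and "0 < \<epsilon>"
  obtains U where "openin weak_star_topology U" "U \<inter> M \<noteq> {}"
    "\<And>x y. \<lbrakk>x \<in> U \<inter> M; y \<in> U \<inter> M\<rbrakk> \<Longrightarrow> norm (x - y) \<le> \<epsilon>"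
proof (rule ccontr)
  note thesisI = that
  assume "\<not> thesis"
  then have large: "\<exists>x\<in>U \<inter> M. \<exists>x'\<in>U \<inter> M. norm (x - x') > \<epsilon>"
    if "openin weak_star_topology U \<and> U \<inter> M \<noteq> {}" for U
    using that thesisI[of U] \<open>\<not> thesis\<close> by (meson not_le)
  define good where "good U \<longleftrightarrow> openin weak_star_topology U \<and> U \<inter> M \<noteq> {}" for U
  have "\<exists>y a U0 U1. norm y \<le> 1 \<and> good U0 \<and> U0 \<subseteq> U \<and> (\<forall>z\<in>U0. a + \<epsilon> \<le> blinfun_apply z y) \<and>
            good U1 \<and> U1 \<subseteq> U \<and> (\<forall>z\<in>U1. blinfun_apply z y \<le> a)" if U: "good U" for U
  proof -
    obtain x x' where "x \<in> U \<inter> M" "x' \<in> U \<inter> M" "norm (x - x') > \<epsilon>"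
      using large U unfolding good_def by blast
    then show ?thesis
      using split_large_diameter[of U x M x' \<epsilon>] U \<open>0 < \<epsilon>\<close> unfolding good_def by metis
  qed
  then obtain y a U0 U1 where split: "\<And>U. good U \<Longrightarrow> norm (y U) \<le> 1 \<and> good (U0 U) \<and> U0 U \<subseteq> U \<and>
       (\<forall>z\<in>U0 U. a U + \<epsilon> \<le> blinfun_apply z (y U)) \<and> good (U1 U) \<and> U1 U \<subseteq> U \<and> 
       (\<forall>z\<in>U1 U. blinfun_apply z (y U) \<le> a U)"
    by metis
  \<comment> \<open>Words grow at the head: the successors of the node \<open>\<sigma>\<close> are \<open>True # \<sigma>\<close> and \<open>False # \<sigma>\<close>.\<close>
  define V where "V \<sigma> = foldr (\<lambda>t U. if t then U0 U else U1 U) \<sigma> UNIV" for \<sigma>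
  have V_Cons: "V (True # \<sigma>) = U0 (V \<sigma>)" "V (False # \<sigma>) = U1 (V \<sigma>)" for \<sigma>
    by (simp_all add: V_def)
  have good: "good (V \<sigma>)" for \<sigma>
  proof (induction \<sigma>)
    case Nil
    show ?case
      using M openin_topspace[of weak_star_topology] by (auto simp: V_def good_def)
  next
    case (Cons t \<sigma>)
    then show ?case
      using split by (cases t) (auto simp: V_Cons)
  qed
  have V_sub: "V (t # \<sigma>) \<subseteq> V \<sigma>" for t \<sigma>
    using split[OF good[of \<sigma>]] by (cases t) (auto simp: V_Cons)
  define gap where "gap \<sigma> x x' \<longleftrightarrow> \<epsilon> \<le> blinfun_apply x (y (V \<sigma>)) - blinfun_apply x' (y (V \<sigma>))" 
    for \<sigma> and x x' :: "'y \<Rightarrow>\<^sub>L real"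
  have hull_gap: "gap \<sigma> x x'"
    if x: "x \<in> convex hull (V (True # \<sigma>) \<inter> M)" and x': "x' \<in> convex hull (V (False # \<sigma>) \<inter> M)"
    for \<sigma> x x'
  proof -
    let ?y = "y (V \<sigma>)" and ?a = "a (V \<sigma>)"
    have cvx: "convex {x. blinfun_apply x ?y \<in> C}" if "convex C" for C
      using that by (auto simp: convex_def blinfun.add_left blinfun.scaleR_left)
    have "convex hull (V (True # \<sigma>) \<inter> M) \<subseteq> {x. blinfun_apply x ?y \<in> {?a + \<epsilon>..}}"
      using split[OF good[of \<sigma>]] by (intro hull_minimal cvx) (auto simp: V_Cons)
    moreover have "convex hull (V (False # \<sigma>) \<inter> M) \<subseteq> {x. blinfun_apply x ?y \<in> {..?a}}"
      using split[OF good[of \<sigma>]] by (intro hull_minimal cvx) (auto simp: V_Cons)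
    ultimately have "?a + \<epsilon> \<le> blinfun_apply x ?y" "blinfun_apply x' ?y \<le> ?a"
      using x x' by auto
    then show ?thesis
      by (simp add: gap_def)
  qed
  define T where "T = subtopology weak_star_topology Q"
  define XT where "XT = product_topology (\<lambda>_::bool list. T) UNIV"
  define node where "node \<sigma> b \<longleftrightarrow> b \<sigma> = (1/2) *\<^sub>R (b (True # \<sigma>) + b (False # \<sigma>)) \<and>
                                 gap \<sigma> (b (True # \<sigma>)) (b (False # \<sigma>))" for \<sigma> b
  define N where "N \<sigma> = {b \<in> topspace XT. node \<sigma> b}" for \<sigma>
  have topT: "topspace T = Q" "topspace XT = UNIV \<rightarrow> Q"
    by (auto simp: T_def XT_def)
  have "compact_space XT"
    using comp by (simp add: XT_def T_def compact_space_product_topology compact_space_subtopology)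
  moreover have "closedin XT (N \<sigma>)" for \<sigma>
  proof -
    have proj: "continuous_map XT weak_star_topology (\<lambda>b. b \<tau>)" for \<tau>
      using continuous_map_product_projection[of \<tau> UNIV "\<lambda>_. T"]
      by (simp add: XT_def T_def continuous_map_in_subtopology)
    have avg: "continuous_map XT weak_star_topology (\<lambda>b. (1/2) *\<^sub>R (b (True # \<sigma>) + b (False # \<sigma>)))"
      unfolding continuous_map_weak_star_iff blinfun.scaleR_left blinfun.add_left real_scaleR_def
      by (auto intro!: continuous_intros continuous_map_weak_star_eval[OF proj])
    have "N \<sigma> = {b \<in> topspace XT. b \<sigma> = (1/2) *\<^sub>R (b (True # \<sigma>) + b (False # \<sigma>))} \<inter>
        {b \<in> topspace XT. blinfun_apply (b (True # \<sigma>)) (y (V \<sigma>)) -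
                          blinfun_apply (b (False # \<sigma>)) (y (V \<sigma>)) \<in> {\<epsilon>..}}"
      by (auto simp: N_def node_def gap_def)
    then show ?thesis
      by (simp only:) (intro closedin_Int closedin_continuous_maps_eq[OF Hausdorff_weak_star proj avg]
            closedin_continuous_map_preimage[where Y = euclideanreal] continuous_map_diff
            continuous_map_weak_star_eval[OF proj], simp)
  qed
  moreover have "\<Inter>\<F> \<noteq> {}" if "finite \<F>" "\<F> \<subseteq> range N" for \<F>
  proof -
    obtain F where F: "finite F" "\<F> = N ` F"
      using \<open>finite \<F>\<close> \<open>\<F> \<subseteq> range N\<close> by (meson finite_subset_image)
    then obtain n where n: "\<And>\<sigma>. \<sigma> \<in> F \<Longrightarrow> length \<sigma> < n"
      by (metis bounded_nat_set_is_finite finite_imageI finite_nat_set_iff_bounded imageI)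
    obtain p where p: "\<And>\<sigma>. p \<sigma> \<in> V \<sigma> \<inter> M"
    proof -
      have "\<exists>x. x \<in> V \<sigma> \<inter> M" for \<sigma>
        using good unfolding good_def by blast
      then show ?thesis
        using that by metis
    qed
    \<comment> \<open>\<open>c k \<sigma>\<close> is the average of \<open>p\<close> over the descendants of \<open>\<sigma>\<close> after \<open>k\<close> generations. At depth \<open>n\<close> and
       beyond, truncated subtraction makes the tree \<open>b\<close> equal to \<open>p\<close>.\<close>
    define c where "c = rec_nat p (\<lambda>_ c \<sigma>. (1/2) *\<^sub>R (c (True # \<sigma>) + c (False # \<sigma>)))"
    have c_simps: "c 0 = p" "c (Suc k) \<sigma> = (1/2) *\<^sub>R (c k (True # \<sigma>) + c k (False # \<sigma>))" for k \<sigma>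
      by (simp_all add: c_def)
    have c_hull: "c k \<sigma> \<in> convex hull (V \<sigma> \<inter> M)" for k \<sigma>
    proof (induction k arbitrary: \<sigma>)
      case 0
      then show ?case
        using p by (simp add: c_simps hull_inc)
    next
      case (Suc k)
      have "c k (t # \<sigma>) \<in> convex hull (V \<sigma> \<inter> M)" for t
        using Suc[of "t # \<sigma>"] hull_mono[of "V (t # \<sigma>) \<inter> M" "V \<sigma> \<inter> M" convex] V_sub by blast
      then show ?case
        unfolding c_simps scaleR_add_right by (intro convexD[OF convex_convex_hull]) auto
    qed
    define b where "b \<sigma> = c (n - length \<sigma>) \<sigma>" for \<sigma>
    have "b \<sigma> \<in> Q" for \<sigma>
      using c_hull[of "n - length \<sigma>" \<sigma>] hull_minimal[of "V \<sigma> \<inter> M" Q convex] M \<open>convex Q\<close>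
      by (auto simp: b_def)
    moreover have "node \<sigma> b" if "length \<sigma> < n" for \<sigma>
    proof -
      have "n - length \<sigma> = Suc (n - Suc (length \<sigma>))"
        using that by simp
      then have "b \<sigma> = (1/2) *\<^sub>R (b (True # \<sigma>) + b (False # \<sigma>))"
        by (simp add: b_def c_simps)
      then show ?thesis
        unfolding node_def using hull_gap c_hull by (simp add: b_def)
    qed
    ultimately have "b \<in> \<Inter>\<F>"
      using n F by (auto simp: N_def topT)
    then show ?thesis
      by blast
  qed
  ultimately have "\<Inter>(range N) \<noteq> {}"
    unfolding compact_space_fip by blast
  then obtain b where b: "\<And>\<sigma>. b \<in> N \<sigma>"
    by blast
  have mid: "b \<sigma> = (1/2) *\<^sub>R (b (True # \<sigma>) + b (False # \<sigma>))" for \<sigma>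
    using b[of \<sigma>] by (simp add: N_def node_def)
  have "\<epsilon> \<le> norm (b (True # \<sigma>) - b (False # \<sigma>))" for \<sigma>
  proof -
    have "\<epsilon> \<le> blinfun_apply (b (True # \<sigma>) - b (False # \<sigma>)) (y (V \<sigma>))"
      using b[of \<sigma>] by (simp add: N_def node_def gap_def blinfun.diff_left)
    also have "\<dots> \<le> norm (b (True # \<sigma>) - b (False # \<sigma>)) * norm (y (V \<sigma>))"
      using norm_blinfun[of "b (True # \<sigma>) - b (False # \<sigma>)" "y (V \<sigma>)"] by simp
    also have "\<dots> \<le> norm (b (True # \<sigma>) - b (False # \<sigma>)) * 1"
      using split[OF good[of \<sigma>]] by (intro mult_left_mono) auto
    finally show ?thesis
      by simp
  qed
  then have "\<not> dentable (range b)"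
    using dyadic_tree_not_dentable mid \<open>0 < \<epsilon>\<close> by blast
  moreover have "range b \<subseteq> Q"
    using b[of "[]"] by (auto simp: N_def topT)
  moreover have "bounded (range b)"
    using calculation(2) weak_star_compact_imp_bounded[OF comp] bounded_subset by blast
  ultimately show False
    using rnp unfolding radon_nikodym_property_def by blast
qed

section \<open>Fixed points of distal nonexpansive actions\<close>

lemma closedin_Collect_Ball:
  assumes "\<And>i. i \<in> I \<Longrightarrow> closedin X {x \<in> topspace X. P i x}"
  shows "closedin X {x \<in> topspace X. \<forall>i\<in>I. P i x}"
proof (cases "I = {}")
  case False
  then have "{x \<in> topspace X. \<forall>i\<in>I. P i x} = (\<Inter>i\<in>I. {x \<in> topspace X. P i x})"
    by blast
  then show ?thesis
    using assms False by auto
qed auto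

lemma dynamical_system_subset:
  assumes "dynamical_system act (subtopology X Q)" "M \<subseteq> Q" "\<And>s x. x \<in> M \<Longrightarrow> act s x \<in> M"
  shows "dynamical_system act (subtopology X M)"
proof -
  have "continuous_map (subtopology X M) (subtopology X M) (act s)" for s
  proof -
    have "continuous_map (subtopology X Q) X (act s)"
      using assms(1) by (auto simp: dynamical_system_def continuous_map_in_subtopology)
    then have "continuous_map (subtopology X M) X (act s)"
      using \<open>M \<subseteq> Q\<close> continuous_map_from_subtopology_mono by blast
    then show ?thesis
      using assms(3) by (auto simp: continuous_map_in_subtopology)
  qed
  then show ?thesis
    using assms by (auto simp: dynamical_system_def)
qed

lemma continuous_map_id_weak_star: "continuous_map (subtopology weak_star_topology Q) weak_star_topology (\<lambda>x. x)"
  by (simp add: continuous_map_from_subtopology)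

text \<open>
  On a minimal set the action is topologically distal: if the images of two points came together in
  the weak* topology, at \<open>z\<close> say, then moving \<open>z\<close> into a weak* open set of small diameter (which
  minimality, here in the form of dense orbits, allows) would bring the images norm close as well.
  Hence the maps are invertible in the limit. Their limiting inverses are nonexpansive because the
  norm is lower semicontinuous, so the maps themselves cannot contract.
\<close>

lemma minimal_action_isometric:
  fixes M :: "('y::banach \<Rightarrow>\<^sub>L real) set"
    and act :: "'s::semigroup_mult \<Rightarrow> ('y \<Rightarrow>\<^sub>L real) \<Rightarrow> ('y \<Rightarrow>\<^sub>L real)"
  assumes comp: "compactin weak_star_topology M"
    and fragmented: "\<And>\<epsilon>. 0 < \<epsilon> \<Longrightarrow> \<exists>U. openin weak_star_topology U \<and> U \<inter> M \<noteq> {} \<and>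
                       (\<forall>x\<in>U \<inter> M. \<forall>y\<in>U \<inter> M. norm (x - y) \<le> \<epsilon>)"
    and sys: "dynamical_system act (subtopology weak_star_topology M)"
    and nonexp: "nonexpansive_action act M"
    and distal: "norm_distal act M"
    and dense: "\<And>U x. \<lbrakk>openin weak_star_topology U; U \<inter> M \<noteq> {}; x \<in> M\<rbrakk> \<Longrightarrow> \<exists>s. act s x \<in> U"
  shows "\<And>x y. \<lbrakk>x \<in> M; y \<in> M\<rbrakk> \<Longrightarrow> norm (act s x - act s y) = norm (x - y)"
    and "M \<subseteq> act s ` M"
proof -
  define T where "T = subtopology weak_star_topology M"
  have top: "topspace T = M"
    by (simp add: T_def)
  have T: "compact_space T" "Hausdorff_space T"
    using comp by (simp_all add: T_def compact_space_subtopology Hausdorff_space_subtopology Hausdorff_weak_star)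
  have cont: "continuous_map T T (act s)" for s
    using sys by (simp add: dynamical_system_def T_def)
  have inv: "act s w \<in> M" if "w \<in> M" for s w
    using cont that by (auto simp: continuous_map_def top Pi_iff)
  have mult: "act (s * t) w = act s (act t w)" if "w \<in> M" for s t w
    using sys that by (simp add: dynamical_system_def)
  have top_distal: "(z, z) \<notin> prod_topology T T closure_of (\<lambda>g. (g v, g w)) ` range act"
    if v: "v \<in> M" and w: "w \<in> M" and "v \<noteq> w" for v w z
  proof
    assume z: "(z, z) \<in> prod_topology T T closure_of (\<lambda>g. (g v, g w)) ` range act"
    then have "z \<in> M"
      using closure_of_subset_topspace top by fastforce
    obtain \<delta> where "0 < \<delta>" and \<delta>: "\<And>s. \<delta> \<le> norm (act s v - act s w)"
    proof -
      have "0 \<notin> closure {act s v - act s w | s. True}"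
        using distal v w \<open>v \<noteq> w\<close> unfolding norm_distal_def by blast
      then obtain \<delta> where "\<delta> > 0" "\<And>s. \<not> dist (act s v - act s w) 0 < \<delta>"
        unfolding closure_approachable by blast
      then show ?thesis
        using that by (auto simp: not_less)
    qed
    obtain U where U: "openin weak_star_topology U" "U \<inter> M \<noteq> {}"
      and diam: "\<And>p q. \<lbrakk>p \<in> U \<inter> M; q \<in> U \<inter> M\<rbrakk> \<Longrightarrow> norm (p - q) \<le> \<delta> / 2"
      using fragmented[of "\<delta> / 2"] \<open>0 < \<delta>\<close> by (metis half_gt_zero)
    obtain t where t: "act t z \<in> U"
      using dense U \<open>z \<in> M\<close> by blast
    define W where "W = {p \<in> topspace T. act t p \<in> U \<inter> M}"
    have "openin T (U \<inter> M)"
      using U by (auto simp: T_def openin_subtopology)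
    then have "openin T W"
      unfolding W_def by (rule openin_continuous_map_preimage[OF cont])
    then have "openin (prod_topology T T) (W \<times> W)"
      by (simp add: openin_prod_Times_iff)
    moreover have "(z, z) \<in> W \<times> W"
      using t inv \<open>z \<in> M\<close> by (simp add: W_def top)
    ultimately have "\<exists>p. p \<in> (\<lambda>g. (g v, g w)) ` range act \<and> p \<in> W \<times> W"
      using z[unfolded in_closure_of, THEN conjunct2, rule_format, of "W \<times> W"] by simp
    then obtain s where s: "act s v \<in> W" "act s w \<in> W"
      by auto
    then have "norm (act (t * s) v - act (t * s) w) \<le> \<delta> / 2"
      using diam v w by (simp add: W_def mult)
    then show False
      using \<delta>[of "t * s"] \<open>0 < \<delta>\<close> by linarith
  qed
  have comp': "\<exists>k\<in>range act. \<forall>x\<in>topspace T. k x = g (h x)" if "g \<in> range act" "h \<in> range act" for g h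
    using that mult top by (metis rangeE rangeI)
  have cont': "continuous_map T T g" if "g \<in> range act" for g
    using cont that by auto
  have "topspace T \<subseteq> act s ` topspace T"
    by (rule distal_semigroup_invertible(2)[OF T, where G = "range act" and g = "act s"])
       ((rule cont' comp' top_distal rangeI; simp add: top) | simp)+
  then show "M \<subseteq> act s ` M"
    by (simp add: top)
  fix x y assume x: "x \<in> M" and y: "y \<in> M"
  have closure: "(x, y) \<in> prod_topology T T closure_of (\<lambda>h. (h (act s x), h (act s y))) ` range act"
    by (rule distal_semigroup_invertible(1)[OF T, where G = "range act" and g = "act s"])
       ((rule cont' comp' top_distal rangeI; simp add: top) | simp add: top x y)+
  have "norm (fst (x, y) - snd (x, y)) \<le> norm (act s x - act s y)"
  proof (rule forall_in_closure_of[OF closure])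
    show "norm (fst p - snd p) \<le> norm (act s x - act s y)"
      if "p \<in> (\<lambda>h. (h (act s x), h (act s y))) ` range act" for p
      using that nonexp inv x y by (auto simp: nonexpansive_action_def)
    show "closedin (prod_topology T T) {p \<in> topspace (prod_topology T T).
             norm (fst p - snd p) \<le> norm (act s x - act s y)}"
      by (rule closedin_norm_diff_le)
         (use continuous_map_fst[of T T] continuous_map_snd[of T T] in
          \<open>simp_all add: T_def continuous_map_in_subtopology\<close>)
  qed
  then show "norm (act s x - act s y) = norm (x - y)"
    using nonexp x y by (simp add: nonexpansive_action_def antisym)
qed

text \<open>
  DeMarr's argument. In a minimal convex invariant set \<open>K\<close> there is a minimal invariant set \<open>M\<close>, on
  which the action is by surjective isometries. Suppose that \<open>M\<close> has diameter \<open>d > 0\<close>. Finitely many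
  preimages of a weak* open set of small diameter cover \<open>M\<close>, and these are small as well because
  the action is isometric. The average \<open>u\<close> of one point from each of them has distance at most \<open>r < d\<close>
  from all of \<open>M\<close>. The set of all such points of \<open>K\<close> is convex and invariant, so it is \<open>K\<close>
  and contains \<open>M\<close>, which makes the diameter of \<open>M\<close> at most \<open>r\<close>. So \<open>M\<close> is a single fixed point.
\<close>

lemma distal_nonexpansive_fixed_point:
  fixes Q :: "('y::banach \<Rightarrow>\<^sub>L real) set"
    and act :: "'s::semigroup_mult \<Rightarrow> ('y \<Rightarrow>\<^sub>L real) \<Rightarrow> ('y \<Rightarrow>\<^sub>L real)"
  assumes "Q \<noteq> {}"
    and comp: "compactin weak_star_topology Q"
    and "convex Q"
    and rnp: "radon_nikodym_property Q"
    and sys: "dynamical_system act (subtopology weak_star_topology Q)"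
    and nonexp: "nonexpansive_action act Q"
    and distal: "norm_distal act Q"
  shows "\<exists>x\<in>Q. \<forall>s. act s x = x"
proof -
  define T where "T = subtopology weak_star_topology Q"
  have top: "topspace T = Q" and T: "compact_space T"
    using comp by (simp_all add: T_def compact_space_subtopology)
  have cont: "continuous_map T T (act s)" for s
    using sys by (simp add: dynamical_system_def T_def)
  have mult: "act (s * t) w = act s (act t w)" if "w \<in> Q" for s t w
    using sys that by (simp add: dynamical_system_def)
  define inv where "inv A \<longleftrightarrow> (\<forall>s. \<forall>x\<in>A. act s x \<in> A)" for A
  have "inv Q"
    using cont by (auto simp: inv_def continuous_map_def top Pi_iff)
  obtain K where K: "K \<subseteq> Q" "closedin T K" "K \<noteq> {}" "convex K \<and> inv K"
    and K_min: "\<And>B. \<lbrakk>closedin T B; B \<noteq> {}; convex B \<and> inv B; B \<subseteq> K\<rbrakk> \<Longrightarrow> B = K"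
  proof (rule minimal_closed_set[of T Q "\<lambda>A. convex A \<and> inv A"])
    show "closedin T Q"
      using top closedin_topspace[of T] by simp
    show "convex (\<Inter>\<A>) \<and> inv (\<Inter>\<A>)" if "\<And>A. A \<in> \<A> \<Longrightarrow> convex A \<and> inv A" for \<A>
      using that unfolding inv_def by (meson InterE InterI convex_Inter)
  qed (use T \<open>Q \<noteq> {}\<close> \<open>convex Q\<close> \<open>inv Q\<close> in auto)
  obtain M where M: "M \<subseteq> K" "closedin T M" "M \<noteq> {}" "inv M"
    and M_min: "\<And>B. \<lbrakk>closedin T B; B \<noteq> {}; inv B; B \<subseteq> M\<rbrakk> \<Longrightarrow> B = M"
  proof (rule minimal_closed_set[of T K inv])
    show "inv (\<Inter>\<A>)" if "\<And>A. A \<in> \<A> \<Longrightarrow> inv A" for \<A>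
      using that unfolding inv_def by blast
  qed (use T K in auto)
  have "M \<subseteq> Q"
    using M K by blast
  have dense: "\<exists>s. act s x \<in> U" if U: "openin weak_star_topology U" "U \<inter> M \<noteq> {}" and "x \<in> M" for U x
  proof -
    let ?O = "range (\<lambda>s. act s x)"
    have "?O \<subseteq> M"
      using M(4) \<open>x \<in> M\<close> by (auto simp: inv_def)
    have "T closure_of ?O = M"
    proof (rule M_min)
      show "T closure_of ?O \<noteq> {}"
        using closure_of_subset[of ?O T] \<open>?O \<subseteq> M\<close> \<open>M \<subseteq> Q\<close> top by blast
      show "T closure_of ?O \<subseteq> M"
        using \<open>?O \<subseteq> M\<close> M(2) by (rule closure_of_minimal)
      have "act t ` ?O \<subseteq> ?O" for t
        using \<open>x \<in> M\<close> \<open>M \<subseteq> Q\<close> by (force simp: mult[symmetric] subset_iff)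
      then have "act t ` (T closure_of ?O) \<subseteq> T closure_of ?O" for t
        using continuous_map_image_closure_subset[OF cont] closure_of_mono by (meson order_trans)
      then show "inv (T closure_of ?O)"
        by (auto simp: inv_def)
    qed auto
    moreover obtain w where w: "w \<in> U" "w \<in> M"
      using U by blast
    ultimately have "w \<in> T closure_of ?O"
      by simp
    moreover have "openin T (U \<inter> Q)"
      using U by (auto simp: T_def openin_subtopology)
    ultimately have "\<exists>y. y \<in> ?O \<and> y \<in> U \<inter> Q"
      using w \<open>M \<subseteq> Q\<close> by (meson IntI in_closure_of subsetD)
    then show ?thesis
      by blast
  qed
  have compM: "compactin weak_star_topology M"
    using closedin_compact_space[OF T M(2)] by (simp add: T_def compactin_subtopology)
  have fragmented: "\<exists>U. openin weak_star_topology U \<and> U \<inter> M \<noteq> {} \<and>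
                       (\<forall>x\<in>U \<inter> M. \<forall>y\<in>U \<inter> M. norm (x - y) \<le> \<epsilon>)" if "0 < \<epsilon>" for \<epsilon>
    using radon_nikodym_fragmented[OF comp \<open>convex Q\<close> rnp \<open>M \<subseteq> Q\<close> M(3) that] by metis
  have sysM: "dynamical_system act (subtopology weak_star_topology M)"
    using dynamical_system_subset[OF sys \<open>M \<subseteq> Q\<close>] M(4) by (auto simp: inv_def)
  have nonexpM: "nonexpansive_action act M" and distalM: "norm_distal act M"
    using nonexp distal \<open>M \<subseteq> Q\<close> by (auto simp: nonexpansive_action_def norm_distal_def subset_iff)
  have isom: "norm (act s x - act s y) = norm (x - y)" if "x \<in> M" "y \<in> M" for s x y
    by (rule minimal_action_isometric(1)[OF compM fragmented sysM nonexpM distalM dense that])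
  have onto: "M \<subseteq> act s ` M" for s
    by (rule minimal_action_isometric(2)[OF compM fragmented sysM nonexpM distalM dense])
  have "x = y" if "x \<in> M" "y \<in> M" for x y
  proof (rule ccontr)
    assume "x \<noteq> y"
    define d where "d = diameter M"
    have "bounded M"
      using weak_star_compact_imp_bounded compM .
    have le_d: "norm (p - q) \<le> d" if "p \<in> M" "q \<in> M" for p q
      using diameter_bounded_bound[OF \<open>bounded M\<close> that] by (simp add: d_def dist_norm)
    have "0 < d"
      using le_d[OF that] \<open>x \<noteq> y\<close> by (metis less_le_trans zero_less_norm_iff right_minus_eq)
    obtain U where U: "openin weak_star_topology U" "U \<inter> M \<noteq> {}"
      and diam: "\<And>p q. \<lbrakk>p \<in> U \<inter> M; q \<in> U \<inter> M\<rbrakk> \<Longrightarrow> norm (p - q) \<le> d / 2"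
      using fragmented[of "d / 2"] \<open>0 < d\<close> by (metis half_gt_zero)
    define W where "W t = {p \<in> Q. act t p \<in> U \<inter> Q}" for t
    have "openin T (U \<inter> Q)"
      using U by (auto simp: T_def openin_subtopology)
    then have "openin T (W t)" for t
      unfolding W_def top[symmetric] by (rule openin_continuous_map_preimage[OF cont])
    moreover have "compactin T M"
      using closedin_compact_space[OF T M(2)] .
    moreover have "M \<subseteq> \<Union>(range W)"
    proof
      fix p assume "p \<in> M"
      then obtain t where "act t p \<in> U"
        using dense U by blast
      then show "p \<in> \<Union>(range W)"
        using \<open>p \<in> M\<close> \<open>M \<subseteq> Q\<close> \<open>inv Q\<close> by (auto simp: W_def inv_def)
    qed
    ultimately obtain \<F> where "finite \<F>" "\<F> \<subseteq> range W" "M \<subseteq> \<Union>\<F>"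
      using compactinD[of T M "range W"] by blast
    then obtain I where I: "finite I" "M \<subseteq> (\<Union>t\<in>I. W t)"
      by (metis finite_subset_image)
    then have "I \<noteq> {}"
      using \<open>M \<noteq> {}\<close> by auto
    have "\<exists>p\<in>M. act t p \<in> U" for t
      using onto[of t] U(2) by blast
    then obtain p where p: "\<And>t. p t \<in> M" "\<And>t. act t (p t) \<in> U"
      by metis
    define n where "n = real (card I)"
    have "n > 0"
      using I \<open>I \<noteq> {}\<close> by (simp add: n_def card_gt_0_iff)
    define u where "u = (\<Sum>t\<in>I. (1 / n) *\<^sub>R p t)"
    \<comment> \<open>A point of \<open>M\<close> is within \<open>d / 2\<close> of at least one of the \<open>n\<close> averaged points and within \<open>d\<close>
       of the others.\<close>
    define r where "r = d - d / (2 * n)"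
    have "p t \<in> K" for t
      using p(1) M(1) by blast
    then have "u \<in> K"
      unfolding u_def using I K(4) \<open>n > 0\<close>
      by (intro convex_sum) (auto simp: n_def)
    have u: "norm (u - y) \<le> r" if yM: "y \<in> M" for y
    proof -
      obtain t where t: "t \<in> I" "act t y \<in> U"
        using I(2) yM unfolding W_def by blast
      have "norm (p t - y) = norm (act t (p t) - act t y)"
        using isom p that by simp
      also have "\<dots> \<le> d / 2"
        using diam p t that M(4) by (simp add: inv_def)
      finally have t_le: "norm (p t - y) \<le> d / 2" .
      have "u - y = (\<Sum>t\<in>I. (1 / n) *\<^sub>R (p t - y))"
        using \<open>n > 0\<close> by (simp add: u_def n_def scaleR_diff_right sum_subtractf scaleR_left.sum
              flip: scaleR_sum_right) (simp add: sum_constant_scaleR)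
      also have "norm \<dots> \<le> (\<Sum>t\<in>I. norm (p t - y) / n)"
        using \<open>n > 0\<close> by (intro sum_norm_le) (simp add: divide_inverse mult.commute)
      also have "\<dots> = norm (p t - y) / n + (\<Sum>t\<in>I - {t}. norm (p t - y) / n)"
        using I t by (simp add: sum.remove)
      also have "\<dots> \<le> (d / 2) / n + (\<Sum>t\<in>I - {t}. d / n)"
        using t_le le_d p that \<open>n > 0\<close> by (intro add_mono sum_mono divide_right_mono) auto
      also have "\<dots> = (d / 2) / n + (n - 1) * (d / n)"
        using I t \<open>n > 0\<close> by (simp add: n_def of_nat_diff Suc_le_eq)
      also have "\<dots> = r"
        using \<open>n > 0\<close> by (simp add: r_def field_simps)
      finally show ?thesis .
    qed
    define C where "C = K \<inter> {x \<in> topspace T. \<forall>y\<in>M. norm (x - y) \<le> r}"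
    have "C = K"
    proof (rule K_min)
      show "closedin T C"
        unfolding C_def
        by (intro closedin_Int closedin_Collect_Ball closedin_norm_diff_le K(2))
           (simp_all add: T_def continuous_map_id_weak_star)
      show "C \<noteq> {}"
        using u \<open>u \<in> K\<close> K(1) by (auto simp: C_def top)
      have "C = K \<inter> (\<Inter>y\<in>M. cball y r)"
        using K(1) M(3) by (auto simp: C_def top dist_norm norm_minus_commute)
      moreover have "inv C"
        unfolding inv_def
      proof (intro allI ballI)
        fix s x assume "x \<in> C"
        then have x: "x \<in> K" "x \<in> Q" "\<And>y. y \<in> M \<Longrightarrow> norm (x - y) \<le> r"
          by (auto simp: C_def top)
        have "norm (act s x - z) \<le> r" if "z \<in> M" for z
        proof -
          \<comment> \<open>Distances to all of \<open>M\<close> are controlled because every point of \<open>M\<close> is an image.\<close>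
          obtain y where "y \<in> M" "z = act s y"
            using onto \<open>z \<in> M\<close> by blast
          then show ?thesis
            using nonexp x \<open>M \<subseteq> Q\<close> unfolding nonexpansive_action_def by (meson order_trans subsetD)
        qed
        then show "act s x \<in> C"
          using x K \<open>inv Q\<close> by (auto simp: C_def inv_def top)
      qed
      ultimately show "convex C \<and> inv C"
        using K(4) by (auto intro!: convex_Int convex_INT)
    qed (auto simp: C_def)
    then have "norm (p - q) \<le> r" if "p \<in> M" "q \<in> M" for p q
      using that M(1) by (auto simp: C_def)
    then have "d \<le> r"
      unfolding d_def using \<open>M \<noteq> {}\<close> by (intro diameter_le) auto
    then show False
      using \<open>0 < d\<close> \<open>0 < n\<close> by (simp add: r_def field_simps)
  qed
  moreover obtain x where "x \<in> M"
    using M by blast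
  ultimately show ?thesis
    using M(4) \<open>M \<subseteq> Q\<close> unfolding inv_def by blast
qed

section \<open>Nonexpansive retractions onto fixed point sets\<close>

text \<open>
  Bruck's method. Among the nonexpansive self-maps of \<open>Q\<close> that fix every point of \<open>F\<close>, which form a
  compact set \<open>N\<close> in the product topology, take one, \<open>f\<close>, whose mutual distances
  \<open>norm (f x - f y)\<close> cannot be decreased. Composing with any \<open>g \<in> N\<close> cannot decrease them
  further, so every \<open>g \<in> N\<close> is isometric on the range of \<open>f\<close>. For \<open>x \<in> Q\<close> the set of all \<open>g (f x)\<close>
  with \<open>g \<in> N\<close> is weak* compact, convex and invariant, and therefore contains a fixed point \<open>p\<close>.
  The map \<open>g\<close> with \<open>g (f x) = p\<close> also sends \<open>p = f p\<close> to \<open>p\<close>; being isometric on the range of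
  \<open>f\<close>, it forces \<open>f x = p\<close>. So \<open>f\<close> retracts \<open>Q\<close> onto \<open>F\<close>.
\<close>

lemma fixed_points_nonexpansive_retract:
  fixes Q :: "('y::banach \<Rightarrow>\<^sub>L real) set"
    and act :: "'s \<Rightarrow> ('y \<Rightarrow>\<^sub>L real) \<Rightarrow> ('y \<Rightarrow>\<^sub>L real)"
  assumes comp: "compactin weak_star_topology Q"
    and "convex Q"
    and inv: "\<And>s x. x \<in> Q \<Longrightarrow> act s x \<in> Q"
    and nonexp: "nonexpansive_action act Q"
    and fixed: "\<And>K. \<lbrakk>K \<subseteq> Q; K \<noteq> {}; compactin weak_star_topology K; convex K; \<And>s x. x \<in> K \<Longrightarrow> act s x \<in> K\<rbrakk>
                  \<Longrightarrow> \<exists>x\<in>K. \<forall>s. act s x = x"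
  shows "nonexpansive_retract_of (fixed_points act Q) Q"
proof -
  define F where "F = fixed_points act Q"
  define T where "T = subtopology weak_star_topology Q"
  define XQ where "XQ = product_topology (\<lambda>_. T) Q"
  have top: "topspace T = Q" "topspace XQ = (\<Pi>\<^sub>E _\<in>Q. Q)"
    by (simp_all add: T_def XQ_def)
  have XQ: "compact_space XQ"
    using comp by (simp add: XQ_def T_def compact_space_product_topology compact_space_subtopology)
  have proj: "continuous_map XQ weak_star_topology (\<lambda>f. f x)" if "x \<in> Q" for x
    using continuous_map_product_projection[OF that, of "\<lambda>_. T"]
    by (simp add: XQ_def T_def continuous_map_in_subtopology)
  define N where "N = {f \<in> topspace XQ. (\<forall>x\<in>Q. \<forall>y\<in>Q. norm (f x - f y) \<le> norm (x - y)) \<and> (\<forall>p\<in>F. f p = p)}"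
  define below where "below g f \<longleftrightarrow> (\<forall>x\<in>Q. \<forall>y\<in>Q. norm (g x - g y) \<le> norm (f x - f y))"
    for f g :: "('y \<Rightarrow>\<^sub>L real) \<Rightarrow> ('y \<Rightarrow>\<^sub>L real)"
  have NQ: "f x \<in> Q" if "f \<in> N" "x \<in> Q" for f x
    using that by (auto simp: N_def top)
  have N_nonexp: "norm (f x - f y) \<le> norm (x - y)" if "f \<in> N" "x \<in> Q" "y \<in> Q" for f x y
    using that by (auto simp: N_def)
  have N_fix: "f p = p" if "f \<in> N" "p \<in> F" for f p
    using that by (auto simp: N_def)
  have "F \<subseteq> Q"
    by (auto simp: F_def fixed_points_def)
  have NI: "restrict f Q \<in> N" if "\<And>x. x \<in> Q \<Longrightarrow> f x \<in> Q" "\<And>p. p \<in> F \<Longrightarrow> f p = p"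
    "\<And>x y. \<lbrakk>x \<in> Q; y \<in> Q\<rbrakk> \<Longrightarrow> norm (f x - f y) \<le> norm (x - y)" for f
    using that \<open>F \<subseteq> Q\<close> by (auto simp: N_def top)
  have compose_N: "compose Q g f \<in> N" if "g \<in> N" "f \<in> N" for g f
    unfolding compose_def
    using that by (intro NI) (auto simp: NQ N_fix intro: order_trans[OF N_nonexp N_nonexp])
  have closed_nonexp: "closedin XQ {f \<in> topspace XQ. \<forall>x\<in>Q. \<forall>y\<in>Q. norm (f x - f y) \<le> c x y}" for c
    by (intro closedin_Collect_Ball closedin_norm_diff_le proj)
  have "N = {f \<in> topspace XQ. \<forall>x\<in>Q. \<forall>y\<in>Q. norm (f x - f y) \<le> norm (x - y)} \<inter>
            {f \<in> topspace XQ. \<forall>p\<in>F. f p = p}"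
    by (auto simp: N_def)
  moreover have "closedin XQ {f \<in> topspace XQ. \<forall>p\<in>F. f p = p}"
    using \<open>F \<subseteq> Q\<close> by (intro closedin_Collect_Ball closedin_continuous_maps_eq[OF Hausdorff_weak_star] proj) auto
  ultimately have N: "closedin XQ N"
    using closed_nonexp by (simp only:) (rule closedin_Int)
  have "restrict (\<lambda>x. x) Q \<in> N"
    by (rule NI) auto
  \<comment> \<open>The relation \<open>below\<close> is only a preorder, so minimality is sought among the nonempty closed
     down-sets; any member of a minimal one is a minimal map.\<close>
  then obtain A where A: "A \<subseteq> N" "closedin XQ A" "A \<noteq> {}" and
    down: "\<And>f g. \<lbrakk>f \<in> A; g \<in> N; below g f\<rbrakk> \<Longrightarrow> g \<in> A" and
    min: "\<And>B. \<lbrakk>closedin XQ B; B \<noteq> {}; \<forall>f\<in>B. \<forall>g\<in>N. below g f \<longrightarrow> g \<in> B; B \<subseteq> A\<rbrakk> \<Longrightarrow> B = A"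
    using minimal_closed_set[of XQ N "\<lambda>A. \<forall>f\<in>A. \<forall>g\<in>N. below g f \<longrightarrow> g \<in> A"] XQ N
    by (smt (verit) InterE InterI empty_iff)
  then obtain f where f: "f \<in> A" "f \<in> N"
    by blast
  have below_trans: "below h f" if "below h g" "below g f" for f g h
    using that unfolding below_def by (meson order_trans)
  have minimal: "below f g" if "g \<in> N" "below g f" for g
  proof -
    have "g \<in> A"
      using down f that by blast
    have "{h \<in> N. below h g} = A"
    proof (rule min)
      have "{h \<in> N. below h g} = N \<inter> {h \<in> topspace XQ. \<forall>x\<in>Q. \<forall>y\<in>Q. norm (h x - h y) \<le> norm (g x - g y)}"
        by (auto simp: N_def below_def)
      then show "closedin XQ {h \<in> N. below h g}"
        using N closed_nonexp by (simp only:) (rule closedin_Int)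
      show "{h \<in> N. below h g} \<noteq> {}"
        using that by (auto simp: below_def)
    qed (use below_trans down \<open>g \<in> A\<close> in blast)+
    then show ?thesis
      using f by blast
  qed
  have "f x \<in> F" if x: "x \<in> Q" for x
  proof -
    define K where "K = (\<lambda>g. g (f x)) ` N"
    have fx: "f x \<in> Q"
      using NQ f x by blast
    have "\<exists>p\<in>K. \<forall>s. act s p = p"
    proof (rule fixed)
      show "K \<subseteq> Q" "K \<noteq> {}"
        using NQ fx f by (auto simp: K_def)
      show "compactin weak_star_topology K"
        unfolding K_def using closedin_compact_space[OF XQ N] proj[OF fx] by (rule image_compactin)
      show "convex K"
        unfolding convex_def
      proof (intro ballI allI impI)
        fix p q and u v :: real
        assume "p \<in> K" "q \<in> K" and uv: "0 \<le> u" "0 \<le> v" "u + v = 1"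
        then obtain g h where gh: "g \<in> N" "h \<in> N" "p = g (f x)" "q = h (f x)"
          by (auto simp: K_def)
        have "restrict (\<lambda>z. u *\<^sub>R g z + v *\<^sub>R h z) Q \<in> N"
        proof (rule NI)
          show "u *\<^sub>R g z + v *\<^sub>R h z \<in> Q" if "z \<in> Q" for z
            using convexD[OF \<open>convex Q\<close>] uv gh NQ that by blast
          show "u *\<^sub>R g z + v *\<^sub>R h z = z" if "z \<in> F" for z
            using N_fix[OF gh(1) that] N_fix[OF gh(2) that] uv by (metis scaleR_left_distrib scaleR_one)
          show "norm (u *\<^sub>R g z + v *\<^sub>R h z - (u *\<^sub>R g w + v *\<^sub>R h w)) \<le> norm (z - w)"
            if "z \<in> Q" "w \<in> Q" for z w
          proof -
            have "u *\<^sub>R g z + v *\<^sub>R h z - (u *\<^sub>R g w + v *\<^sub>R h w) = u *\<^sub>R (g z - g w) + v *\<^sub>R (h z - h w)"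
              by (simp add: algebra_simps)
            also have "norm \<dots> \<le> u * norm (g z - g w) + v * norm (h z - h w)"
              using uv norm_triangle_ineq[of "u *\<^sub>R (g z - g w)" "v *\<^sub>R (h z - h w)"] by simp
            also have "\<dots> \<le> u * norm (z - w) + v * norm (z - w)"
              using uv gh N_nonexp that by (intro add_mono mult_left_mono) auto
            also have "\<dots> = norm (z - w)"
              using uv by (simp flip: distrib_right)
            finally show ?thesis .
          qed
        qed
        then have "restrict (\<lambda>z. u *\<^sub>R g z + v *\<^sub>R h z) Q (f x) \<in> K"
          unfolding K_def by (rule imageI)
        then show "u *\<^sub>R p + v *\<^sub>R q \<in> K"
          using gh fx by simp
      qed
      show "act s p \<in> K" if pK: "p \<in> K" for s p
      proof -
        obtain g where g: "g \<in> N" "p = g (f x)"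
          using pK by (auto simp: K_def)
        have "restrict (\<lambda>z. act s (g z)) Q \<in> N"
        proof (rule NI)
          show "act s (g z) = z" if "z \<in> F" for z
            using N_fix[OF g(1) that] that by (simp add: F_def fixed_points_def)
          show "norm (act s (g z) - act s (g w)) \<le> norm (z - w)" if "z \<in> Q" "w \<in> Q" for z w
            using nonexp N_nonexp[OF g(1) that] NQ[OF g(1)] that
            unfolding nonexpansive_action_def by (meson order_trans)
        qed (use inv NQ g in auto)
        then have "restrict (\<lambda>z. act s (g z)) Q (f x) \<in> K"
          unfolding K_def by (rule imageI)
        then show ?thesis
          using g fx by simp
      qed
    qed
    then obtain g where g: "g \<in> N" "\<And>s. act s (g (f x)) = g (f x)"
      by (auto simp: K_def)
    define p where "p = g (f x)"
    have p: "p \<in> F" "p \<in> Q"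
      using g NQ fx by (auto simp: p_def F_def fixed_points_def)
    have fixp: "f p = p" "g p = p"
      using p f g N_fix by blast+
    have "below (compose Q g f) f"
      using g f N_nonexp NQ by (simp add: below_def compose_def)
    then have "below f (compose Q g f)"
      using minimal compose_N g f by blast
    then have "norm (f x - f p) \<le> norm (g (f x) - g (f p))"
      using x p by (simp add: below_def compose_def)
    also have "\<dots> = 0"
      using fixp by (simp flip: p_def)
    finally show ?thesis
      using p fixp by simp
  qed
  moreover have "f p = p" if "p \<in> F" for p
    using N_fix f that by blast
  ultimately show ?thesis
    unfolding nonexpansive_retract_of_def F_def[symmetric]
    using \<open>F \<subseteq> Q\<close> N_nonexp[OF f(2)] by (intro conjI exI[of _ f]) (auto intro!: image_eqI[of _ f])
qed

theorem theoremA: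
  fixes Q :: "('y::banach \<Rightarrow>\<^sub>L real) set"
    and act :: "'s::semigroup_mult \<Rightarrow> ('y \<Rightarrow>\<^sub>L real) \<Rightarrow> ('y \<Rightarrow>\<^sub>L real)"
  assumes "Q \<noteq> {}"
    and "compactin weak_star_topology Q"
    and "convex Q"
    and "radon_nikodym_property Q"
    and "dynamical_system act (subtopology weak_star_topology Q)"
    and "nonexpansive_action act Q"
    and "norm_distal act Q"
  shows "(\<exists>x\<in>Q. \<forall>s. act s x = x) \<and> nonexpansive_retract_of (fixed_points act Q) Q"
proof
  show "\<exists>x\<in>Q. \<forall>s. act s x = x"
    using assms by (rule distal_nonexpansive_fixed_point)
  have inv: "act s x \<in> Q" if "x \<in> Q" for s x
    using assms(5) that by (auto simp: dynamical_system_def continuous_map_def Pi_iff)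
  show "nonexpansive_retract_of (fixed_points act Q) Q"
  proof (rule fixed_points_nonexpansive_retract)
    fix K assume K: "K \<subseteq> Q" "K \<noteq> {}" "compactin weak_star_topology K" "convex K"
      and invK: "\<And>s x. x \<in> K \<Longrightarrow> act s x \<in> K"
    show "\<exists>x\<in>K. \<forall>s. act s x = x"
    proof (rule distal_nonexpansive_fixed_point)
      show "radon_nikodym_property K"
        using assms(4) K(1) unfolding radon_nikodym_property_def by blast
      show "dynamical_system act (subtopology weak_star_topology K)"
        using dynamical_system_subset[OF assms(5) K(1)] invK by blast
      show "nonexpansive_action act K" "norm_distal act K"
        using assms(6,7) K(1) by (auto simp: nonexpansive_action_def norm_distal_def subset_iff)
    qed (use K in auto)
  qed (use assms inv in auto)
qed

end
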